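(* Let $\mathrm{W}$ be the Witt algebra over $\mathbb{C}$. Then $$\mathrm{Q}\mathfrak{Der}(\mathrm{W}) = \mathfrak{Der}(\mathrm{W}) \oplus \mathfrak{Der}_{\frac12}(\mathrm{W}),$$ i.e. every quasi-derivation of $\mathrm{W}$ is, in a unique way, the sum of a derivation and a $\frac12$-derivation.
   Context: All algebras and vector spaces are over $\mathbb{C}$. The Witt algebra $\mathrm{W}$ is the Lie algebra with basis $\{L_i\}_{i\in\mathbb{Z}}$ and multiplication $[L_i,L_j]=(i-j)L_{i+j}$. For a Lie algebra $\mathfrak{L}$: a linear map $f:\mathfrak{L}\to\mathfrak{L}$ is a quasi-derivation if there is a linear map $f':\mathfrak{L}\to\mathfrak{L}$ with $[f(x),y]+[x,f(y)]=f'([x,y])$ for all $x,y$; the space of quasi-derivations is $\mathrm{Q}\mathfrak{Der}(\mathfrak{L})$. For $\delta\in\mathbb{C}$, a linear map $\varphi:\mathfrak{L}\to\mathfrak{L}$ is a $\delta$-derivation if $\varphi([x,y])=\delta\big([\varphi(x),y]+[x,\varphi(y)]\big)$ for all $x,y$; the space of these is $\mathfrak{Der}_\delta(\mathfrak{L})$. $\mathfrak{Der}(\mathfrak{L})=\mathfrak{Der}_1(\mathfrak{L})$ is the space of derivations. $\oplus$ denotes the direct sum of vector spaces. *)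

theory Defs
  imports Complex_Main "HOL-Library.Poly_Mapping" "HOL-Library.Function_Algebras"
begin

definition (in vector_space) internal_direct_sum :: "'b set \<Rightarrow> 'b set \<Rightarrow> 'b set \<Rightarrow> bool"
  where "internal_direct_sum V A B \<longleftrightarrow>
    subspace A \<and> subspace B \<and> V = {a + b |a b. a \<in> A \<and> b \<in> B} \<and> A \<inter> B = {0}"

locale lie_algebra = vector_space scale
  for scale :: "complex \<Rightarrow> 'a::ab_group_add \<Rightarrow> 'a" +
  fixes bracket :: "'a \<Rightarrow> 'a \<Rightarrow> 'a"
  assumes bracket_linear_left: "Vector_Spaces.linear scale scale (\<lambda>x. bracket x y)"
    and bracket_linear_right: "Vector_Spaces.linear scale scale (\<lambda>y. bracket x y)"
    and bracket_self: "bracket x x = 0"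
    and jacobi: "bracket x (bracket y z) + bracket y (bracket z x) + bracket z (bracket x y) = 0"
begin

definition quasi_derivations :: "('a \<Rightarrow> 'a) set"
  where "quasi_derivations = {f. Vector_Spaces.linear scale scale f \<and>
    (\<exists>f'. Vector_Spaces.linear scale scale f' \<and>
      (\<forall>x y. bracket (f x) y + bracket x (f y) = f' (bracket x y)))}"

definition delta_derivations :: "complex \<Rightarrow> ('a \<Rightarrow> 'a) set"
  where "delta_derivations \<delta> = {\<phi>. Vector_Spaces.linear scale scale \<phi> \<and>
    (\<forall>x y. \<phi> (bracket x y) = scale \<delta> (bracket (\<phi> x) y + bracket x (\<phi> y)))}"

definition derivations :: "('a \<Rightarrow> 'a) set"
  where "derivations = delta_derivations 1"

end

text \<open>The pointwise vector space structure on maps, in which the above spaces of maps live;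
  addition and zero are those of \<^theory>\<open>HOL-Library.Function_Algebras\<close>.\<close>

sublocale lie_algebra \<subseteq> maps: vector_space "\<lambda>c (f :: 'a \<Rightarrow> 'a) x. scale c (f x)"
  by unfold_locales
    (simp_all add: fun_eq_iff scale_right_distrib scale_left_distrib)

text \<open>An element is a finitely supported function \<^typ>\<open>int \<Rightarrow>\<^sub>0 complex\<close>, the family of its
  coordinates with respect to the basis of the \<open>witt_L i\<close>.\<close>

definition witt_scale :: "complex \<Rightarrow> (int \<Rightarrow>\<^sub>0 complex) \<Rightarrow> (int \<Rightarrow>\<^sub>0 complex)"
  where "witt_scale c = Poly_Mapping.map ((*) c)"

definition witt_L :: "int \<Rightarrow> (int \<Rightarrow>\<^sub>0 complex)"
  where "witt_L i = Poly_Mapping.single i 1"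

text \<open>The bilinear extension of \<open>[L\<^sub>i, L\<^sub>j] = (i - j) L\<^sub>i\<^sub>+\<^sub>j\<close>.\<close>

definition witt_bracket :: "(int \<Rightarrow>\<^sub>0 complex) \<Rightarrow> (int \<Rightarrow>\<^sub>0 complex) \<Rightarrow> (int \<Rightarrow>\<^sub>0 complex)"
  where "witt_bracket x y =
    (\<Sum>i\<in>Poly_Mapping.keys x. \<Sum>j\<in>Poly_Mapping.keys y.
      witt_scale (Poly_Mapping.lookup x i * Poly_Mapping.lookup y j * of_int (i - j)) (witt_L (i + j)))"

lemma lookup_witt_scale [simp]:
  "Poly_Mapping.lookup (witt_scale c x) k = c * Poly_Mapping.lookup x k"
  by (simp add: witt_scale_def map.rep_eq when_def)

interpretation witt_vs: vector_space witt_scale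
  by unfold_locales (auto intro!: poly_mapping_eqI simp: lookup_add algebra_simps)

lemma witt_scale_L: "witt_scale c (witt_L i) = Poly_Mapping.single i c"
  by (intro poly_mapping_eqI) (simp add: witt_L_def lookup_single when_def)

lemma witt_expansion:
  "x = (\<Sum>i\<in>Poly_Mapping.keys x. witt_scale (Poly_Mapping.lookup x i) (witt_L i))"
  by (intro poly_mapping_eqI)
    (simp add: lookup_sum witt_scale_L lookup_single when_def in_keys_iff)

lemma inj_witt_L: "inj witt_L"
  by (auto simp: inj_def witt_L_def dest: arg_cong[where f = Poly_Mapping.keys])

lemma span_witt_L: "witt_vs.span (range witt_L) = UNIV"
proof -
  have "x \<in> witt_vs.span (range witt_L)" for x
    by (subst witt_expansion)
      (intro witt_vs.span_sum witt_vs.span_scale witt_vs.span_base rangeI)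
  then show ?thesis by auto
qed

lemma independent_witt_L: "witt_vs.independent (range witt_L)"
proof
  assume "witt_vs.dependent (range witt_L)"
  then obtain t u where t: "finite t" "t \<subseteq> range witt_L"
    and z: "(\<Sum>v\<in>t. witt_scale (u v) v) = 0" and nz: "\<exists>v\<in>t. u v \<noteq> 0"
    unfolding witt_vs.dependent_explicit by blast
  from nz t obtain k where k: "witt_L k \<in> t" "u (witt_L k) \<noteq> 0" by blast
  have "Poly_Mapping.lookup (\<Sum>v\<in>t. witt_scale (u v) v) k = (\<Sum>v\<in>t. if v = witt_L k then u v else 0)"
    unfolding lookup_sum
  proof (rule sum.cong)
    fix v assume "v \<in> t"
    with t obtain i where "v = witt_L i" by blast
    then show "Poly_Mapping.lookup (witt_scale (u v) v) k = (if v = witt_L k then u v else 0)"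
      by (auto simp: inj_eq[OF inj_witt_L]) (auto simp: witt_L_def lookup_single when_def)
  qed simp
  with z k t show False by simp
qed

lemma witt_bracket_superset:
  assumes "finite A" "finite B" "Poly_Mapping.keys x \<subseteq> A" "Poly_Mapping.keys y \<subseteq> B"
  shows "witt_bracket x y = (\<Sum>i\<in>A. \<Sum>j\<in>B.
      witt_scale (Poly_Mapping.lookup x i * Poly_Mapping.lookup y j * of_int (i - j)) (witt_L (i + j)))"
proof -
  have "witt_bracket x y = (\<Sum>i\<in>Poly_Mapping.keys x. \<Sum>j\<in>B.
      witt_scale (Poly_Mapping.lookup x i * Poly_Mapping.lookup y j * of_int (i - j)) (witt_L (i + j)))"
    unfolding witt_bracket_def
    by (intro sum.cong refl sum.mono_neutral_left) (use assms in \<open>auto simp: in_keys_iff\<close>)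
  also have "\<dots> = (\<Sum>i\<in>A. \<Sum>j\<in>B.
      witt_scale (Poly_Mapping.lookup x i * Poly_Mapping.lookup y j * of_int (i - j)) (witt_L (i + j)))"
    by (intro sum.mono_neutral_left) (use assms in \<open>auto simp: in_keys_iff\<close>)
  finally show ?thesis .
qed

lemma witt_bracket_L: "witt_bracket (witt_L i) (witt_L j) = witt_scale (of_int (i - j)) (witt_L (i + j))"
  by (simp add: witt_bracket_def witt_L_def)

lemma witt_bracket_swap: "witt_bracket y x = - witt_bracket x y"
proof -
  have "witt_bracket y x = (\<Sum>i\<in>Poly_Mapping.keys x. \<Sum>j\<in>Poly_Mapping.keys y.
      witt_scale (Poly_Mapping.lookup y j * Poly_Mapping.lookup x i * of_int (j - i)) (witt_L (j + i)))"
    unfolding witt_bracket_def by (rule sum.swap)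
  also have "\<dots> = - witt_bracket x y"
    unfolding witt_bracket_def sum_negf[symmetric]
    by (intro sum.cong refl poly_mapping_eqI) (simp add: algebra_simps)
  finally show ?thesis .
qed

lemma witt_bracket_add_left: "witt_bracket (x + x') y = witt_bracket x y + witt_bracket x' y"
proof -
  let ?A = "Poly_Mapping.keys x \<union> Poly_Mapping.keys x'"
  let ?B = "Poly_Mapping.keys y"
  have "Poly_Mapping.keys (x + x') \<subseteq> ?A" by (rule Poly_Mapping.keys_add)
  then show ?thesis
    by (simp add: witt_bracket_superset[of ?A ?B] lookup_add sum.distrib
        witt_vs.scale_left_distrib distrib_right)
qed

lemma witt_bracket_scale_left: "witt_bracket (witt_scale c x) y = witt_scale c (witt_bracket x y)"
proof -
  have "Poly_Mapping.keys (witt_scale c x) \<subseteq> Poly_Mapping.keys x"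
    by (auto simp: in_keys_iff)
  then show ?thesis
    by (simp add: witt_bracket_superset[of "Poly_Mapping.keys x" "Poly_Mapping.keys y"]
        witt_vs.scale_sum_right mult.assoc)
qed

lemma witt_bracket_add_right: "witt_bracket x (y + y') = witt_bracket x y + witt_bracket x y'"
  by (simp add: witt_bracket_swap[of x] witt_bracket_add_left)

lemma witt_bracket_scale_right: "witt_bracket x (witt_scale c y) = witt_scale c (witt_bracket x y)"
  by (simp add: witt_bracket_swap[of x] witt_bracket_scale_left)

lemma witt_jacobi:
  "witt_bracket x (witt_bracket y z) + witt_bracket y (witt_bracket z x)
    + witt_bracket z (witt_bracket x y) = 0" (is "?J x y z = 0")
proof -
  note add = witt_bracket_add_left witt_bracket_add_right
  note scale = witt_bracket_scale_left witt_bracket_scale_right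
  have vanish: "F x = 0"
    if "Vector_Spaces.linear witt_scale witt_scale F" "\<And>i. F (witt_L i) = 0" for F x
  proof -
    interpret F: Vector_Spaces.linear witt_scale witt_scale F by (fact that)
    show ?thesis
      using F.eq_0_on_span[of "range witt_L" x] that(2) span_witt_L by auto
  qed
  have L: "?J (witt_L i) (witt_L j) (witt_L k) = 0" for i j k
    by (simp add: witt_bracket_L scale ac_simps flip: witt_vs.scale_left_distrib)
      (simp add: algebra_simps)
  have 1: "Vector_Spaces.linear witt_scale witt_scale (\<lambda>x. ?J x y z)"
    and 2: "Vector_Spaces.linear witt_scale witt_scale (\<lambda>y. ?J x y z)"
    and 3: "Vector_Spaces.linear witt_scale witt_scale (\<lambda>z. ?J x y z)" for x y z
    by (unfold_locales; simp add: add scale witt_vs.scale_right_distrib)+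
  have "?J (witt_L i) (witt_L j) z = 0" for i j z
    using vanish[OF 3 L] by simp
  then have "?J (witt_L i) y z = 0" for i y z
    using vanish[OF 2] by simp
  then show ?thesis
    using vanish[OF 1] by simp
qed

interpretation witt: lie_algebra witt_scale witt_bracket
proof unfold_locales
  show "witt_bracket x x = 0" for x
  proof (rule poly_mapping_eqI)
    fix k
    show "Poly_Mapping.lookup (witt_bracket x x) k = Poly_Mapping.lookup 0 k"
      using arg_cong[OF witt_bracket_swap[of x x], of "\<lambda>p. Poly_Mapping.lookup p k"] by simp
  qed
qed (simp_all add: witt_bracket_add_left witt_bracket_add_right
    witt_bracket_scale_left witt_bracket_scale_right witt_jacobi)

end

theory Submission
  imports Defs
begin

text \<open>
  The algebra is \<open>\<int>\<close>-graded, so the component of degree \<open>k\<close> of a quasi-derivation sends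
  \<open>L\<^sub>i\<close> to \<open>d i L\<^sub>i\<^sub>+\<^sub>k\<close>, where \<open>d\<close> satisfies
  \<open>(i + k - j) d i + (i - j - k) d j = (i - j) g (i + j)\<close> for some \<open>g\<close>. The solutions \<open>d\<close> of
  this functional equation are the affine functions of \<open>i\<close>. An affine function is a combination
  of \<open>k - i\<close>, which comes from \<open>ad L\<^sub>k\<close>, and of \<open>1\<close>, which comes from the
  \<open>\<onehalf>\<close>-derivation \<open>L\<^sub>i \<mapsto> L\<^sub>k\<^sub>+\<^sub>i\<close>, multiplication by \<open>L\<^sub>k\<close> in the Laurent polynomials. Since
  \<open>d\<close> is determined by \<open>d 0\<close> and \<open>d 1\<close>, only finitely many \<open>k\<close> contribute. The sum is direct
  because the Witt algebra is perfect.
\<close>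

section \<open>Direct sums and delta-derivations in general\<close>

text \<open>Two decompositions of the same vector differ by an element of \<open>A\<close> that also
  lies in \<open>B\<close>, hence by 0.\<close>

lemma (in vector_space) internal_direct_sum_unique_decomposition:
  assumes "internal_direct_sum V A B" "f \<in> V"
  shows "\<exists>!p. p \<in> A \<times> B \<and> f = fst p + snd p"
proof -
  have A: "subspace A" and B: "subspace B" and V: "V = {a + b |a b. a \<in> A \<and> b \<in> B}"
    and AB: "A \<inter> B = {0}"
    using assms(1) unfolding internal_direct_sum_def by auto
  obtain a b where ab: "a \<in> A" "b \<in> B" "f = a + b"
    using assms(2) V by auto
  show ?thesis
  proof (rule ex1I[of _ "(a, b)"])
    fix p assume p: "p \<in> A \<times> B \<and> f = fst p + snd p"
    then have eq: "fst p - a = b - snd p"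
      using ab by (simp add: algebra_simps)
    moreover have "fst p - a \<in> A" "b - snd p \<in> B"
      using p ab subspace_diff[OF A] subspace_diff[OF B] by auto
    ultimately have "fst p - a \<in> A \<inter> B"
      by simp
    then have "fst p - a = 0" "b - snd p = 0"
      unfolding eq AB by simp_all
    then show "p = (a, b)"
      by (simp add: prod_eq_iff)
  qed (use ab in auto)
qed

context lie_algebra
begin

lemma bracket_add_left: "bracket (x + y) z = bracket x z + bracket y z"
  and bracket_scale_left: "bracket (scale c x) z = scale c (bracket x z)"
  and bracket_add_right: "bracket z (x + y) = bracket z x + bracket z y"
  and bracket_scale_right: "bracket z (scale c x) = scale c (bracket z x)"
proof -
  interpret l: Vector_Spaces.linear scale scale "\<lambda>x. bracket x z" by (rule bracket_linear_left)
  interpret r: Vector_Spaces.linear scale scale "bracket z" by (rule bracket_linear_right)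
  show "bracket (x + y) z = bracket x z + bracket y z" by (rule l.add)
  show "bracket (scale c x) z = scale c (bracket x z)" by (rule l.scale)
  show "bracket z (x + y) = bracket z x + bracket z y" by (rule r.add)
  show "bracket z (scale c x) = scale c (bracket z x)" by (rule r.scale)
qed

lemma linear_map_add:
  assumes "Vector_Spaces.linear scale scale f" "Vector_Spaces.linear scale scale g"
  shows "Vector_Spaces.linear scale scale (f + g)"
proof -
  interpret f: Vector_Spaces.linear scale scale f by fact
  interpret g: Vector_Spaces.linear scale scale g by fact
  show ?thesis
    by unfold_locales (simp_all add: f.add g.add f.scale g.scale scale_right_distrib)
qed

lemma linear_map_scale:
  assumes "Vector_Spaces.linear scale scale f"
  shows "Vector_Spaces.linear scale scale (\<lambda>x. scale c (f x))"
proof -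
  interpret f: Vector_Spaces.linear scale scale f by fact
  show ?thesis
    by unfold_locales (simp_all add: f.add f.scale scale_right_distrib mult.commute)
qed

lemma linear_map_zero: "Vector_Spaces.linear scale scale 0"
  by unfold_locales simp_all

lemma bracket_zero_left: "bracket 0 y = 0"
  using bracket_scale_left[of 0 0 y] by simp

lemma bracket_zero_right: "bracket y 0 = 0"
  using bracket_scale_right[of y 0 0] by simp

lemma bracket_swap: "bracket y x = - bracket x y"
proof -
  have "0 = bracket (x + y) (x + y)" by (simp only: bracket_self)
  also have "\<dots> = bracket x y + bracket y x"
    by (simp only: bracket_add_left bracket_add_right) (simp add: bracket_self)
  finally show ?thesis
    by (metis add.commute eq_neg_iff_add_eq_0)
qed

lemma subspace_delta_derivations: "maps.subspace (delta_derivations \<delta>)"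
proof (rule maps.subspaceI)
  show "0 \<in> delta_derivations \<delta>"
    by (simp add: delta_derivations_def linear_map_zero bracket_zero_left bracket_zero_right)
  show "f + g \<in> delta_derivations \<delta>"
    if "f \<in> delta_derivations \<delta>" "g \<in> delta_derivations \<delta>" for f g
    using that
    by (auto simp: delta_derivations_def linear_map_add bracket_add_left bracket_add_right
        scale_right_distrib algebra_simps)
  show "(\<lambda>x. scale c (f x)) \<in> delta_derivations \<delta>" if "f \<in> delta_derivations \<delta>" for c f
    using that
    by (auto simp: delta_derivations_def linear_map_scale bracket_scale_left bracket_scale_right
        scale_right_distrib mult.commute)
qed

lemma derivation_add_half_derivation_quasi:
  assumes "D \<in> derivations" "h \<in> delta_derivations (1/2)"
  shows "D + h \<in> quasi_derivations"
proof -
  have D: "Vector_Spaces.linear scale scale D"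
    "\<And>x y. D (bracket x y) = bracket (D x) y + bracket x (D y)"
    and h: "Vector_Spaces.linear scale scale h"
    "\<And>x y. h (bracket x y) = scale (1/2) (bracket (h x) y + bracket x (h y))"
    using assms by (auto simp: derivations_def delta_derivations_def)
  \<comment> \<open>The Leibniz sum of \<open>h\<close> is twice \<open>h\<close> of the bracket, so
    the companion map of \<open>D + h\<close> is \<open>D + 2 h\<close>.\<close>
  have "bracket ((D + h) x) y + bracket x ((D + h) y) = (D + (\<lambda>x. scale 2 (h x))) (bracket x y)"
    for x y
    by (simp add: D h bracket_add_left bracket_add_right)
  moreover have "Vector_Spaces.linear scale scale (D + (\<lambda>x. scale 2 (h x)))"
    by (intro linear_map_add linear_map_scale D h)
  ultimately show ?thesis
    using linear_map_add[OF D(1) h(1)] unfolding quasi_derivations_def by blast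
qed

text \<open>The Jacobi identity, with two of its terms turned round by antisymmetry.\<close>

lemma ad_derivation: "bracket v \<in> derivations"
proof -
  have "bracket v (bracket x y) = bracket (bracket v x) y + bracket x (bracket v y)" for x y
  proof -
    have "bracket v (bracket x y) + bracket x (bracket y v) + bracket y (bracket v x) = 0"
      by (rule jacobi)
    moreover have "bracket x (bracket y v) = - bracket x (bracket v y)"
      using bracket_scale_right[of x "-1" "bracket v y"] by (simp add: bracket_swap[of v y])
    moreover have "bracket y (bracket v x) = - bracket (bracket v x) y"
      by (rule bracket_swap)
    ultimately show ?thesis
      by (simp add: algebra_simps)
  qed
  then show ?thesis
    by (simp add: derivations_def delta_derivations_def bracket_linear_right)
qed

text \<open>The same Leibniz sum equals both \<open>f [x, y]\<close> and
  \<open>2 f [x, y]\<close>.\<close>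

lemma derivation_half_derivation_bracket:
  assumes "f \<in> derivations" "f \<in> delta_derivations (1/2)"
  shows "f (bracket x y) = 0"
proof -
  have "f (bracket x y) = bracket (f x) y + bracket x (f y)"
    "f (bracket x y) = scale (1/2) (bracket (f x) y + bracket x (f y))"
    using assms by (auto simp: derivations_def delta_derivations_def)
  then have "scale (1/2) (f (bracket x y)) = scale 1 (f (bracket x y))"
    by simp
  then show ?thesis
    by (simp only: scale_cancel_right) simp
qed

end

section \<open>The functional equation in a fixed degree\<close>

text \<open>Normalised to \<open>d 0 = d 1 = 0\<close>, the equation at \<open>(4,0)\<close>, \<open>(3,1)\<close>, \<open>(3,0)\<close>, \<open>(2,1)\<close>,
  \<open>(4,1)\<close> and \<open>(3,2)\<close> forces \<open>12 d 2 = 0\<close>, whatever \<open>k\<close> is.\<close>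

lemma quasi_derivation_equation_normalized:
  fixes d g :: "int \<Rightarrow> complex"
  assumes E: "\<And>i j. of_int (i + k - j) * d i + of_int (i - j - k) * d j = of_int (i - j) * g (i + j)"
    and d0: "d 0 = 0" and d1: "d 1 = 0"
  shows "d i = 0"
proof -
  define K :: complex where "K = of_int k"
  have d2: "d 2 = 0"
  proof -
    have e: "(3 + K) * d 3 = 3 * g 3" "(1 + K) * d 2 = g 3"
      "(4 + K) * d 4 = 4 * g 4" "(2 + K) * d 3 = 2 * g 4"
      "(3 + K) * d 4 = 3 * g 5" "(1 + K) * d 3 + (1 - K) * d 2 = g 5"
      using E[of 3 0] E[of 2 1] E[of 4 0] E[of 3 1] E[of 4 1] E[of 3 2] d0 d1
      by (simp_all add: K_def algebra_simps)
    \<comment> \<open>Eliminating the other unknowns leaves two cubics in \<open>K\<close> times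
      \<open>d 2\<close>: 2(K+1)(K+2)(K+3) and 3(K+4)(K+1)^2 + (K+4)(K+3)(1-K). They differ by the
      constant 12, so no \<open>K\<close> is exceptional.\<close>
    have "12 * d 2 = 0"
      using e by algebra
    then show ?thesis by simp
  qed
  have pos: "d (int n) = 0 \<and> d (int n + 1) = 0" for n
  proof (induction n)
    case 0
    then show ?case using d0 d1 by simp
  next
    case (Suc n)
    define i where "i = int n + 2"
    have prev: "d (i - 1) = 0" using Suc by (simp add: i_def add.commute)
    have "d i = 0"
    proof (cases "n = 0")
      case True
      then show ?thesis using d2 by (simp add: i_def)
    next
      case False
      then have i: "i \<ge> 3" by (simp add: i_def)
      \<comment> \<open>The pair \<open>(i - 1, 1)\<close> has sum \<open>i\<close> and involves
        only known zeros of \<open>d\<close>. It gives \<open>g i = 0\<close> because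
        \<open>i\<close> is not 2, which is why \<open>d 2\<close> needs its own argument.\<close>
      have "of_int (i - 2) * g i = 0"
        using E[of "i - 1" 1] prev d1 by simp
      then have g: "g i = 0" using i by (simp del: of_int_diff)
      have z: "of_int (i + k) * d i = 0"
        using E[of i 0] g d0 by simp
      show ?thesis
      proof (cases "i + k = 0")
        case True
        \<comment> \<open>For \<open>i = -k\<close> the pair \<open>(i, 0)\<close> says nothing
          about \<open>d i\<close>. The pair \<open>(i, 2)\<close> has coefficient -2 instead, and
          \<open>g (i + 2)\<close> is found from \<open>(i + 1, 1)\<close>, where the unknown
          \<open>d (i + 1)\<close> has coefficient \<open>i + k = 0\<close>.\<close>
        have "of_int i * g (i + 2) = 0"
          using E[of "i + 1" 1] True d1 by (simp add: add.commute)
        then have "g (i + 2) = 0" using i by simp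
        then have "of_int (i + k - 2) * d i = 0"
          using E[of i 2] d2 by simp
        then show ?thesis using True by (simp del: of_int_diff of_int_add)
      next
        case False
        then show ?thesis using z by (simp del: of_int_add)
      qed
    qed
    moreover have "int (Suc n) = i - 1" "int (Suc n) + 1 = i" by (simp_all add: i_def)
    ultimately show ?case using prev by metis
  qed
  have nonneg: "d m = 0" if "m \<ge> 0" for m
    using pos[of "nat m"] that by simp
  have g: "g m = 0" if "m > 0" for m
    using E[of m 0] nonneg[of m] d0 that by simp
  \<comment> \<open>So large that \<open>d j\<close> and \<open>g (i + j)\<close> vanish and the
    coefficient of \<open>d i\<close> does not.\<close>
  define j where "j = \<bar>i\<bar> + \<bar>k\<bar> + 1"
  have "of_int (i + k - j) * d i = 0"
    using E[of i j] nonneg[of j] g[of "i + j"] by (simp add: j_def)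
  moreover have "i + k - j \<noteq> 0"
    by (simp add: j_def)
  ultimately show ?thesis
    by (simp del: of_int_diff of_int_add)
qed

text \<open>The affine function \<open>a + b i\<close> solves the equation with
  \<open>g m = 2 a + (m + k) b\<close>. Subtracting the one that agrees with \<open>d\<close> at 0
  and 1 leaves a normalised solution.\<close>

lemma quasi_derivation_equation_affine:
  fixes d g :: "int \<Rightarrow> complex"
  assumes E: "\<And>i j. of_int (i + k - j) * d i + of_int (i - j - k) * d j = of_int (i - j) * g (i + j)"
  shows "d i = d 0 + of_int i * (d 1 - d 0)"
proof -
  define a b where "a = d 0" and "b = d 1 - d 0"
  have "d i - a - of_int i * b = 0"
  proof (rule quasi_derivation_equation_normalized[where k = k and d = "\<lambda>i. d i - a - of_int i * b"
        and g = "\<lambda>m. g m - 2 * a - of_int (m + k) * b"])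
    show "of_int (i + k - j) * (d i - a - of_int i * b)
        + of_int (i - j - k) * (d j - a - of_int j * b)
        = of_int (i - j) * (g (i + j) - 2 * a - of_int (i + j + k) * b)" for i j
      using E[of i j] by (simp add: algebra_simps)
  qed (simp_all add: a_def b_def)
  then show ?thesis by (simp add: a_def b_def algebra_simps)
qed

section \<open>Coordinates and Laurent multiplication on the Witt algebra\<close>

lemma witt_linear_eqI:
  assumes "Vector_Spaces.linear witt_scale witt_scale f" "Vector_Spaces.linear witt_scale witt_scale g"
    and "\<And>i. f (witt_L i) = g (witt_L i)"
  shows "f = g"
proof
  fix x
  interpret vector_space_pair witt_scale witt_scale ..
  show "f x = g x"
    using linear_eq_on_span[OF assms(1,2), of "range witt_L" x] assms(3) span_witt_L by auto
qed

lemma lookup_witt_bracket_L_right: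
  "Poly_Mapping.lookup (witt_bracket x (witt_L j)) n = of_int (n - 2 * j) * Poly_Mapping.lookup x (n - j)"
proof -
  have "Poly_Mapping.lookup (witt_bracket x (witt_L j)) n
      = (\<Sum>i\<in>Poly_Mapping.keys x. if i = n - j then Poly_Mapping.lookup x i * of_int (i - j) else 0)"
    unfolding witt_bracket_def lookup_sum
    by (intro sum.cong) (auto simp: witt_L_def lookup_single when_def)
  then show ?thesis
    by (simp add: in_keys_iff mult.commute)
qed

lemma lookup_witt_bracket_L_left:
  "Poly_Mapping.lookup (witt_bracket (witt_L i) y) n = of_int (2 * i - n) * Poly_Mapping.lookup y (n - i)"
  by (subst witt_bracket_swap) (simp add: lookup_witt_bracket_L_right algebra_simps)

lemma witt_L_times: "witt_L i * witt_L j = witt_L (i + j)"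
  by (simp add: witt_L_def mult_single)

lemma lookup_times_single:
  fixes x :: "int \<Rightarrow>\<^sub>0 complex"
  shows "Poly_Mapping.lookup (x * Poly_Mapping.single j c) n = Poly_Mapping.lookup x (n - j) * c"
proof -
  have "x * Poly_Mapping.single j c
      = (\<Sum>i\<in>Poly_Mapping.keys x. Poly_Mapping.single (i + j) (Poly_Mapping.lookup x i * c))"
    by (subst witt_expansion[of x]) (simp add: sum_distrib_right witt_scale_L mult_single)
  also have "Poly_Mapping.lookup \<dots> n
      = (\<Sum>i\<in>Poly_Mapping.keys x. if i = n - j then Poly_Mapping.lookup x i * c else 0)"
    unfolding lookup_sum by (intro sum.cong) (auto simp: lookup_single when_def)
  finally show ?thesis
    by (simp add: in_keys_iff)
qed

text \<open>Scaling becomes a ring multiplication, so its compatibility with \<open>*\<close>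
  follows from the commutative ring laws.\<close>

lemma witt_scale_eq_times: "witt_scale c x = x * Poly_Mapping.single 0 c"
  by (intro poly_mapping_eqI) (simp add: lookup_times_single)

lemma witt_scale_times_left: "witt_scale c x * y = witt_scale c (x * y)"
  and witt_scale_times_right: "x * witt_scale c y = witt_scale c (x * y)"
  by (simp_all add: witt_scale_eq_times ac_simps)

lemma lookup_times_witt_L:
  "Poly_Mapping.lookup (x * witt_L j) n = Poly_Mapping.lookup x (n - j)"
  by (simp add: witt_L_def lookup_times_single)

lemma linear_witt_times: "Vector_Spaces.linear witt_scale witt_scale (\<lambda>x. u * x)"
  by unfold_locales (simp_all add: distrib_left witt_scale_times_right)

text \<open>On basis vectors this is (k + i - j) + (i - k - j) = 2(i - j). Both sides are linear in
  \<open>u\<close>, \<open>x\<close> and \<open>y\<close>, so the identity extends one argument at a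
  time.\<close>

lemma times_half_derivation: "(\<lambda>x. u * x) \<in> witt.delta_derivations (1/2)"
proof -
  note bilinear = witt_bracket_add_left witt_bracket_add_right witt_bracket_scale_left
    witt_bracket_scale_right witt_scale_times_left witt_scale_times_right distrib_left distrib_right
    witt_vs.scale_right_distrib
  let ?l = "\<lambda>u x y. u * witt_bracket x y"
  let ?r = "\<lambda>u x y. witt_scale (1/2) (witt_bracket (u * x) y + witt_bracket x (u * y))"
  have L: "?l (witt_L k) (witt_L i) (witt_L j) = ?r (witt_L k) (witt_L i) (witt_L j)" for k i j
    by (simp add: witt_bracket_L witt_L_times bilinear ac_simps flip: witt_vs.scale_left_distrib)
  have "Vector_Spaces.linear witt_scale witt_scale (\<lambda>u. ?l u x y)"
    "Vector_Spaces.linear witt_scale witt_scale (\<lambda>u. ?r u x y)"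
    "Vector_Spaces.linear witt_scale witt_scale (\<lambda>x. ?l u x y)"
    "Vector_Spaces.linear witt_scale witt_scale (\<lambda>x. ?r u x y)"
    "Vector_Spaces.linear witt_scale witt_scale (\<lambda>y. ?l u x y)"
    "Vector_Spaces.linear witt_scale witt_scale (\<lambda>y. ?r u x y)" for u x y
    by (unfold_locales; simp add: bilinear mult.commute)+
  note linear = this
  have "?l (witt_L k) (witt_L i) y = ?r (witt_L k) (witt_L i) y" for k i y
    using fun_cong[OF witt_linear_eqI[OF linear(5,6) L]] .
  then have "?l (witt_L k) x y = ?r (witt_L k) x y" for k x y
    using fun_cong[OF witt_linear_eqI[OF linear(3,4)]] by blast
  then have "?l u x y = ?r u x y" for x y
    using fun_cong[OF witt_linear_eqI[OF linear(1,2)]] by blast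
  then show ?thesis
    unfolding witt.delta_derivations_def using linear_witt_times by blast
qed

section \<open>Existence and directness of the decomposition\<close>

lemma quasi_derivation_decomposition:
  assumes "f \<in> witt.quasi_derivations"
  shows "\<exists>u v. f = witt_bracket v + (\<lambda>x. u * x)"
proof -
  obtain f' where f: "Vector_Spaces.linear witt_scale witt_scale f"
    and f': "\<And>x y. witt_bracket (f x) y + witt_bracket x (f y) = f' (witt_bracket x y)"
    and f'_linear: "Vector_Spaces.linear witt_scale witt_scale f'"
    using assms unfolding witt.quasi_derivations_def by blast
  interpret f': Vector_Spaces.linear witt_scale witt_scale f' by (rule f'_linear)
  define d where "d k i = Poly_Mapping.lookup (f (witt_L i)) (i + k)" for k i
  define g where "g k m = Poly_Mapping.lookup (f' (witt_L m)) (m + k)" for k m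
  have "of_int (i + k - j) * d k i + of_int (i - j - k) * d k j = of_int (i - j) * g k (i + j)"
    for i j k
  proof -
    have "Poly_Mapping.lookup (f' (witt_bracket (witt_L i) (witt_L j))) (i + j + k)
        = of_int (i - j) * g k (i + j)"
      by (simp add: witt_bracket_L f'.scale g_def)
    then show ?thesis
      unfolding f'[symmetric]
      by (simp add: lookup_add lookup_witt_bracket_L_left lookup_witt_bracket_L_right d_def
          algebra_simps)
  qed
  then have affine: "d k i = d k 0 + of_int i * (d k 1 - d k 0)" for k i
    by (rule quasi_derivation_equation_affine)
  \<comment> \<open>The coefficient of \<open>i\<close> in the value of \<open>ad v\<close> on
    \<open>L_i\<close> in degree \<open>k\<close> is minus the \<open>k\<close>-th coordinate of
    \<open>v\<close>, so \<open>v\<close> must have coordinates \<open>d k 0 - d k 1\<close>.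
    Multiplying by \<open>witt_L (-1)\<close> aligns the degrees, and building \<open>v\<close> from
    values of \<open>f\<close> makes its support finite.\<close>
  define v where "v = f (witt_L 0) - f (witt_L 1) * witt_L (-1)"
  \<comment> \<open>\<open>witt_L 0\<close> is the unit of \<open>*\<close>, so this choice makes
    the two sides agree there.\<close>
  define u where "u = f (witt_L 0) - witt_bracket v (witt_L 0)"
  have v: "Poly_Mapping.lookup v k = d k 0 - d k 1" for k
    by (simp add: v_def lookup_minus lookup_times_witt_L d_def add.commute)
  have u: "Poly_Mapping.lookup u k = d k 0 - of_int k * (d k 0 - d k 1)" for k
    by (simp add: u_def lookup_minus lookup_witt_bracket_L_right v) (simp add: d_def)
  have "f = witt_bracket v + (\<lambda>x. u * x)"
  proof (rule witt_linear_eqI)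
    show "Vector_Spaces.linear witt_scale witt_scale (witt_bracket v + (\<lambda>x. u * x))"
      by (intro witt.linear_map_add witt.bracket_linear_right linear_witt_times)
    show "f (witt_L i) = (witt_bracket v + (\<lambda>x. u * x)) (witt_L i)" for i
    proof (rule poly_mapping_eqI)
      fix n
      have "Poly_Mapping.lookup (f (witt_L i)) n = d (n - i) i"
        by (simp add: d_def)
      also have "\<dots> = of_int (n - 2 * i) * Poly_Mapping.lookup v (n - i) + Poly_Mapping.lookup u (n - i)"
        by (subst affine) (simp add: u v algebra_simps)
      finally show "Poly_Mapping.lookup (f (witt_L i)) n
          = Poly_Mapping.lookup ((witt_bracket v + (\<lambda>x. u * x)) (witt_L i)) n"
        by (simp add: lookup_add lookup_witt_bracket_L_right lookup_times_witt_L)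
    qed
  qed (rule f)
  then show ?thesis by blast
qed

text \<open>[L_m, L_0] = m L_m reaches every basis vector but \<open>L_0\<close>, and [L_1, L_{-1}]
  = 2 L_0 supplies that one. A linear map that kills all brackets is therefore zero.\<close>

lemma witt_perfect: "\<exists>c i j. witt_L m = witt_scale c (witt_bracket (witt_L i) (witt_L j))"
proof (cases "m = 0")
  case True
  then have "witt_L m = witt_scale (1/2) (witt_bracket (witt_L 1) (witt_L (-1)))"
    by (simp add: witt_bracket_L)
  then show ?thesis by blast
next
  case False
  then have "witt_L m = witt_scale (1 / of_int m) (witt_bracket (witt_L m) (witt_L 0))"
    by (simp add: witt_bracket_L)
  then show ?thesis by blast
qed

lemma witt_derivation_half_derivation_zero:
  assumes "f \<in> witt.derivations" "f \<in> witt.delta_derivations (1/2)"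
  shows "f = 0"
proof (rule witt_linear_eqI)
  show f: "Vector_Spaces.linear witt_scale witt_scale f"
    using assms(2) by (simp add: witt.delta_derivations_def)
  interpret f: Vector_Spaces.linear witt_scale witt_scale f by (rule f)
  show "f (witt_L m) = 0 (witt_L m)" for m
    using witt_perfect[of m] witt.derivation_half_derivation_bracket[OF assms]
    by (auto simp: f.scale)
qed (rule witt.linear_map_zero)

theorem theorem7:
  shows "witt.maps.internal_direct_sum
      witt.quasi_derivations witt.derivations (witt.delta_derivations (1/2))
    \<and> (\<forall>f\<in>witt.quasi_derivations.
        \<exists>!p. p \<in> witt.derivations \<times> witt.delta_derivations (1/2) \<and> f = fst p + snd p)"
proof -
  have "witt.quasi_derivations
      = {D + h |D h. D \<in> witt.derivations \<and> h \<in> witt.delta_derivations (1/2)}"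
  proof (intro equalityI subsetI)
    fix f assume "f \<in> witt.quasi_derivations"
    then show "f \<in> {D + h |D h. D \<in> witt.derivations \<and> h \<in> witt.delta_derivations (1/2)}"
      using quasi_derivation_decomposition witt.ad_derivation times_half_derivation by blast
  qed (use witt.derivation_add_half_derivation_quasi in blast)
  moreover have sub: "witt.maps.subspace witt.derivations"
    "witt.maps.subspace (witt.delta_derivations (1/2))"
    unfolding witt.derivations_def by (rule witt.subspace_delta_derivations)+
  moreover have "witt.derivations \<inter> witt.delta_derivations (1/2) = {0}"
    using witt_derivation_half_derivation_zero sub[THEN witt.maps.subspace_0] by blast
  ultimately have "witt.maps.internal_direct_sum
      witt.quasi_derivations witt.derivations (witt.delta_derivations (1/2))"
    unfolding witt.maps.internal_direct_sum_def by blast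
  then show ?thesis
    using witt.maps.internal_direct_sum_unique_decomposition by blast
qed

end
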